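(* For any constant integer $d\ge 1$, there exist co-bipartite graphs that do not have a $d$-dot product representation.
   Context: Graphs are finite and simple. A co-bipartite graph is the complement of a bipartite graph. A $d$-dot product representation of a graph $G=(V,E)$ is an assignment of vectors $\mathbf{a}^u\in\mathbb{R}^d$ ($u\in V$) together with a threshold $t>0$ such that, for all distinct $u,v\in V$, $uv\in E$ if and only if $\mathbf{a}^u\cdot\mathbf{a}^v\ge t$ (one may take $t=1$ by scaling). *)

theory Defs
  imports "Graph_Theory.Pair_Digraph" "Jordan_Normal_Form.Matrix"
begin

text \<open>
  A finite simple undirected graph is a \<^locale>\<open>pair_graph\<close>: a finite loop-free digraph whose
  arc set \<^const>\<open>parcs\<close> is symmetric, the edge uv being the pair of arcs (u, v) and (v, u).
\<close>

definition complement :: "'a pair_pre_digraph \<Rightarrow> 'a pair_pre_digraph" where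
  "complement G =
    \<lparr> pverts = pverts G,
      parcs = {(u, v). u \<in> pverts G \<and> v \<in> pverts G \<and> u \<noteq> v \<and> (u, v) \<notin> parcs G} \<rparr>"

definition bipartite :: "'a pair_pre_digraph \<Rightarrow> bool" where
  "bipartite G \<longleftrightarrow> pair_graph G \<and>
    (\<exists>A B. A \<union> B = pverts G \<and> A \<inter> B = {} \<and>
      (\<forall>(u, v) \<in> parcs G. u \<in> A \<and> v \<in> B \<or> u \<in> B \<and> v \<in> A))"

definition co_bipartite :: "'a pair_pre_digraph \<Rightarrow> bool" where
  "co_bipartite G \<longleftrightarrow> (\<exists>H. bipartite H \<and> G = complement H)"

definition dot_product_representation ::
    "nat \<Rightarrow> 'a pair_pre_digraph \<Rightarrow> ('a \<Rightarrow> real vec) \<Rightarrow> real \<Rightarrow> bool" where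
  "dot_product_representation d G a t \<longleftrightarrow>
    t > 0 \<and>
    (\<forall>u \<in> pverts G. a u \<in> carrier_vec d) \<and>
    (\<forall>u \<in> pverts G. \<forall>v \<in> pverts G. u \<noteq> v \<longrightarrow> ((u, v) \<in> parcs G \<longleftrightarrow> a u \<bullet> a v \<ge> t))"

definition has_dot_product_representation :: "nat \<Rightarrow> 'a pair_pre_digraph \<Rightarrow> bool" where
  "has_dot_product_representation d G \<longleftrightarrow> (\<exists>a t. dot_product_representation d G a t)"

end

theory Submission
  imports Defs "Jordan_Normal_Form.Determinant" "HOL-Library.Nat_Bijection"
begin

text \<open>
  Any \<open>d + 2\<close> points of real \<open>d\<close>-space are affinely dependent, so (as in Radon's theorem) some
  subset \<open>P\<close> of them cannot be cut off by a half-space. In the co-bipartite graph on \<open>d + 2\<close>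
  vertices together with one vertex for each subset of them, adjacent to exactly its elements, the
  vector of the vertex belonging to \<open>P\<close> would cut off \<open>P\<close>.
\<close>

text \<open>The coefficients form a nonzero kernel vector of a square matrix whose columns are the
  points extended by ones: the coordinate rows make the weighted sum of the points vanish, a row of
  ones the sum of the coefficients.\<close>

lemma affine_dependence_exists:
  fixes a :: "nat \<Rightarrow> real vec"
  assumes "\<And>i. i < d + 2 \<Longrightarrow> a i \<in> carrier_vec d"
  obtains c where "\<exists>i<d + 2. c i \<noteq> 0" "(\<Sum>i<d + 2. c i) = 0"
    "\<forall>w \<in> carrier_vec d. (\<Sum>i<d + 2. c i * (a i \<bullet> w)) = 0"
proof -
  \<comment> \<open>The last row repeats the row of ones, so that the matrix is square and singular.\<close>
  define M where "M = mat (d + 2) (d + 2) (\<lambda>(k, i). if k < d then a i $ k else 1)"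
  have M: "M \<in> carrier_mat (d + 2) (d + 2)"
    by (simp add: M_def)
  have "row M d = row M (d + 1)"
    by (rule eq_vecI) (auto simp: M_def)
  then have "det M = 0"
    by (intro det_identical_rows[OF M, of d "d + 1"]) auto
  then obtain v where v: "v \<in> carrier_vec (d + 2)" "v \<noteq> 0\<^sub>v (d + 2)" "M *\<^sub>v v = 0\<^sub>v (d + 2)"
    using det_0_iff_vec_prod_zero_field[OF M] by auto
  have eq: "(\<Sum>i<d + 2. (if k < d then a i $ k else 1) * v $ i) = 0" if "k < d + 2" for k
  proof -
    have "(M *\<^sub>v v) $ k = 0"
      using v(3) that by simp
    then show ?thesis
      using that v(1) M
      by (simp add: M_def scalar_prod_def lessThan_atLeast0 del: sum.op_ivl_Suc sum.lessThan_Suc)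
  qed
  show thesis
  proof (rule that)
    show "\<exists>i<d + 2. v $ i \<noteq> 0"
      using v(1,2) by (metis carrier_vecD dim_vec eq_vecI index_zero_vec)
    show "(\<Sum>i<d + 2. v $ i) = 0"
      using eq[of d] by (simp del: sum.lessThan_Suc)
    show "\<forall>w \<in> carrier_vec d. (\<Sum>i<d + 2. v $ i * (a i \<bullet> w)) = 0"
    proof
      fix w :: "real vec"
      assume w: "w \<in> carrier_vec d"
      have "(\<Sum>i<d + 2. v $ i * (a i \<bullet> w)) = (\<Sum>i<d + 2. \<Sum>k<d. w $ k * (a i $ k * v $ i))"
        using w by (simp add: scalar_prod_def sum_distrib_left lessThan_atLeast0 mult_ac
            del: sum.op_ivl_Suc sum.lessThan_Suc)
      \<comment> \<open>After the exchange each inner sum is entry \<open>k\<close> of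
        \<open>M *\<^sub>v v\<close>, hence zero by \<open>eq\<close>.\<close>
      also have "\<dots> = (\<Sum>k<d. w $ k * (\<Sum>i<d + 2. a i $ k * v $ i))"
        unfolding sum_distrib_left by (rule sum.swap)
      also have "\<dots> = 0"
      proof (intro sum.neutral ballI)
        show "w $ k * (\<Sum>i<d + 2. a i $ k * v $ i) = 0" if "k \<in> {..<d}" for k
          using eq[of k] that by (simp del: sum.lessThan_Suc)
      qed
      finally show "(\<Sum>i<d + 2. v $ i * (a i \<bullet> w)) = 0" .
    qed
  qed
qed

text \<open>Let \<open>P\<close> collect the indices with positive coefficient in an affine
  dependence. If \<open>w\<close> cut off \<open>P\<close> at threshold \<open>t\<close>, no term
  \<open>c i * (a i \<bullet> w - t)\<close> would be negative and some would be positive, yet they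
  sum to zero.\<close>

lemma not_all_subsets_cut_off_by_halfspaces:
  fixes a :: "nat \<Rightarrow> real vec"
  assumes "\<And>i. i < d + 2 \<Longrightarrow> a i \<in> carrier_vec d"
  shows "\<exists>P \<subseteq> {..<d + 2}. \<forall>w \<in> carrier_vec d. \<exists>i<d + 2. (i \<in> P) \<noteq> (a i \<bullet> w \<ge> t)"
proof -
  obtain c where c: "\<exists>i<d + 2. c i \<noteq> 0" "(\<Sum>i<d + 2. c i) = 0"
    "\<forall>w \<in> carrier_vec d. (\<Sum>i<d + 2. c i * (a i \<bullet> w)) = 0"
    using assms by (rule affine_dependence_exists)
  \<comment> \<open>Strictness has to come from a negative coefficient: where
    \<open>c i > 0\<close>, the product \<open>a i \<bullet> w\<close> may equal \<open>t\<close>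
    and the term may vanish.\<close>
  have "\<exists>i<d + 2. c i < 0"
  proof (rule ccontr)
    assume "\<not> ?thesis"
    then have "\<And>i. i \<in> {..<d + 2} \<Longrightarrow> 0 \<le> c i"
      by (meson lessThan_iff not_less)
    then have "\<forall>i \<in> {..<d + 2}. c i = 0"
      using c(2) sum_nonneg_eq_0_iff[of "{..<d + 2}" c] by blast
    then show False
      using c(1) by auto
  qed
  then obtain j where j: "j < d + 2" "c j < 0"
    by blast
  have "\<exists>i<d + 2. (c i > 0) \<noteq> (a i \<bullet> w \<ge> t)" if w: "w \<in> carrier_vec d" for w
  proof (rule ccontr)
    assume "\<not> ?thesis"
    then have cut: "c i > 0 \<longleftrightarrow> a i \<bullet> w \<ge> t" if "i < d + 2" for i
      using that by blast
    have "0 < (\<Sum>i<d + 2. c i * (a i \<bullet> w - t))"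
    proof (rule sum_pos2)
      show "0 < c j * (a j \<bullet> w - t)"
        using cut[OF j(1)] j(2) by (intro mult_neg_neg) auto
      show "0 \<le> c i * (a i \<bullet> w - t)" if "i \<in> {..<d + 2}" for i
        using cut[of i] that by (auto simp: zero_le_mult_iff)
    qed (use j in auto)
    also have "\<dots> = (\<Sum>i<d + 2. c i * (a i \<bullet> w)) - (\<Sum>i<d + 2. c i) * t"
      by (simp only: right_diff_distrib sum_subtractf sum_distrib_right)
    also have "\<dots> = 0"
      using c(2) c(3) w by simp
    finally show False
      by simp
  qed
  then show ?thesis
    by (intro exI[of _ "{i \<in> {..<d + 2}. c i > 0}"]) auto
qed

lemma pair_graph_complement:
  assumes "pair_graph H"
  shows "pair_graph (complement H)"
proof -
  interpret pair_graph H by fact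
  have "finite (parcs (complement H))"
    by (rule finite_subset[of _ "pverts H \<times> pverts H"]) (auto simp: complement_def)
  then show ?thesis
    using arcs_symmetric
    by unfold_locales (auto simp: complement_def symmetric_def intro!: symI)
qed

text \<open>
  The vertex \<open>n + set_encode S\<close> stands for the subset \<open>S\<close> of \<open>{..<n}\<close>. Arcs are
  non-incidences because the graph is going to be complemented.
\<close>

definition non_incidence_graph :: "nat \<Rightarrow> nat pair_pre_digraph" where
  "non_incidence_graph n =
    \<lparr> pverts = {..<n} \<union> (\<lambda>S. n + set_encode S) ` Pow {..<n},
      parcs = (\<Union>S \<in> Pow {..<n}. \<Union>i \<in> {..<n} - S.
        {(i, n + set_encode S), (n + set_encode S, i)}) \<rparr>"

lemma bipartite_non_incidence_graph: "bipartite (non_incidence_graph n)"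
proof -
  have "pair_graph (non_incidence_graph n)"
    by unfold_locales (auto simp: non_incidence_graph_def symmetric_def intro!: symI)
  moreover have "{..<n} \<inter> (\<lambda>S. n + set_encode S) ` Pow {..<n} = {}"
    by auto
  ultimately show ?thesis
    unfolding bipartite_def
    by (intro conjI exI[of _ "{..<n}"] exI[of _ "(\<lambda>S. n + set_encode S) ` Pow {..<n}"])
      (auto simp: non_incidence_graph_def)
qed

lemma arc_complement_non_incidence_graph_iff:
  assumes "i < n" "S \<subseteq> {..<n}"
  shows "(i, n + set_encode S) \<in> parcs (complement (non_incidence_graph n)) \<longleftrightarrow> i \<in> S"
proof -
  \<comment> \<open>A non-incidence arc at the code of \<open>S\<close> could a priori stem from
    another subset with the same code. \<open>set_encode\<close> is injective only on finite sets,
    hence the bound on \<open>T\<close>.\<close>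
  have unique: "S = T" if "set_encode S = set_encode T" "T \<subseteq> {..<n}" for T
    using set_encode_eq[of S T] that assms(2) by (meson finite_lessThan finite_subset)
  show ?thesis
    using assms by (auto simp: complement_def non_incidence_graph_def dest: unique)
qed

theorem mainTheorem8:
  fixes d :: nat
  assumes "d \<ge> 1"
  shows "\<exists>G :: nat pair_pre_digraph.
    pair_graph G \<and> co_bipartite G \<and> \<not> has_dot_product_representation d G"
proof (intro exI conjI)
  let ?H = "non_incidence_graph (d + 2)"
  show "pair_graph (complement ?H)"
    using bipartite_non_incidence_graph[of "d + 2"]
    by (intro pair_graph_complement) (simp add: bipartite_def)
  show "co_bipartite (complement ?H)"
    using bipartite_non_incidence_graph by (auto simp: co_bipartite_def)
  show "\<not> has_dot_product_representation d (complement ?H)"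
  proof
    assume "has_dot_product_representation d (complement ?H)"
    then obtain a t where rep: "dot_product_representation d (complement ?H) a t"
      by (auto simp: has_dot_product_representation_def)
    have left: "i \<in> pverts (complement ?H)" if "i < d + 2" for i
      using that by (simp add: complement_def non_incidence_graph_def)
    have right: "d + 2 + set_encode S \<in> pverts (complement ?H)" if "S \<subseteq> {..<d + 2}" for S
      using that by (simp add: complement_def non_incidence_graph_def)
    have "a i \<in> carrier_vec d" if "i < d + 2" for i
      using rep left[OF that] by (auto simp: dot_product_representation_def)
    then obtain P where P: "P \<subseteq> {..<d + 2}"
      "\<forall>w \<in> carrier_vec d. \<exists>i<d + 2. (i \<in> P) \<noteq> (a i \<bullet> w \<ge> t)"
      using not_all_subsets_cut_off_by_halfspaces[of d a t] by blast
    let ?p = "d + 2 + set_encode P"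
    have "a ?p \<in> carrier_vec d"
      using rep right[OF P(1)] by (auto simp: dot_product_representation_def)
    then obtain i where i: "i < d + 2" "(i \<in> P) \<noteq> (a i \<bullet> a ?p \<ge> t)"
      using P(2) by blast
    \<comment> \<open>A representation constrains distinct vertices only; the shift by
      \<open>d + 2\<close> keeps codes of subsets apart from points.\<close>
    have "i \<noteq> ?p"
      using i(1) by simp
    then have "(i, ?p) \<in> parcs (complement ?H) \<longleftrightarrow> a i \<bullet> a ?p \<ge> t"
      using rep left[OF i(1)] right[OF P(1)]
      unfolding dot_product_representation_def by blast
    then show False
      using i(2) arc_complement_non_incidence_graph_iff[OF i(1) P(1)] by simp
  qed
qed

end
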